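(* Let $(F^*,B^* )$ and $(F^\dagger,B^\dagger)$, with $F^*,F^\dagger\in\mathbb R^{T\times r}$ and $B^*,B^\dagger\in\mathbb R^{N\times r}$, both satisfy the following condition on a pair $(F,B)$: (i) the smallest eigenvalues of $B'B$ and of $T^{-1}F'F$ are bounded away from zero, and (ii) the $r$ eigenvalues of $B'B(T^{-1}F'F)$ are distinct. Suppose $F^\dagger B^{\dagger\prime}=F^*B^{*\prime}$. Let $H$ and $H^\dagger$ be the rotation matrices constructed (as described in the context) from $(F^*,B^* )$ and $(F^\dagger,B^\dagger)$ respectively, and let $F^0=F^*H$, $B^0=B^*H^{\prime-1}$. Then $F^\dagger H^\dagger=F^0$ and $B^\dagger H^{\dagger\prime-1}=B^0$ hold up to simultaneous column sign changes; that is, there is a diagonal matrix $S$ with diagonal entries $\pm1$ such that $F^\dagger H^\dagger=F^0S$ and $B^\dagger H^{\dagger\prime-1}=B^0S$.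
   Context: A prime denotes transpose, and $H^{\prime-1}=(H')^{-1}$. $N,T,r$ are positive integers. Construction of the rotation matrix from a pair $(F,B)$ satisfying (i)–(ii): let $\Lambda$ be the diagonal matrix of eigenvalues of $B'B(T^{-1}F'F)$ in descending order, $P$ the $r\times r$ matrix whose columns are the corresponding unit-norm eigenvectors, so $B'B(T^{-1}F'F)P=P\Lambda$; let $V=P'(T^{-1}F'F)P$ (a diagonal matrix with positive diagonal entries); the rotation matrix is $PV^{-1/2}$. ("Bounded away from zero" means bounded below by a positive constant not depending on $N,T$; for fixed $N,T$ it amounts to positive definiteness.) *)

theory Defs
  imports
    Complex_Main
    "Jordan_Normal_Form.Matrix"
    "Jordan_Normal_Form.Gauss_Jordan_Elimination"
    "Jordan_Normal_Form.Char_Poly"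
    "Jordan_Normal_Form.Spectral_Radius"
begin

definition second_moment :: "real mat \<Rightarrow> real mat" where
  "second_moment F = (1 / real (dim_row F)) \<cdot>\<^sub>m (transpose_mat F * F)"

definition eig_matrix :: "real mat \<Rightarrow> real mat \<Rightarrow> real mat" where
  "eig_matrix F B = (transpose_mat B * B) * second_moment F"

definition smallest_eigenvalue :: "real mat \<Rightarrow> real" where
  "smallest_eigenvalue A = Min (spectrum A)"

text \<open>The spectrum is taken over the reals. In the last condition nothing is lost by this:
  by the other conditions the matrix is a product of two symmetric positive definite matrices,
  so all its eigenvalues are real, and having \<open>r\<close> of them (with multiplicity) pairwise distinct
  means that there are \<open>r\<close> different ones. The bound \<open>c\<close> is a parameter, so that it can be chosen
  uniformly over all dimensions.\<close>

definition factor_condition :: "real \<Rightarrow> real mat \<Rightarrow> real mat \<Rightarrow> bool" where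
  "factor_condition c F B \<longleftrightarrow>
     0 < c \<and>
     c \<le> smallest_eigenvalue (transpose_mat B * B) \<and>
     c \<le> smallest_eigenvalue (second_moment F) \<and>
     card (spectrum (eig_matrix F B)) = dim_col F"

text \<open>Meaningful only when the square matrix \<open>A\<close> has as many different eigenvalues as rows;
  otherwise some list index is out of range.\<close>

definition descending_eigenvalue_matrix :: "real mat \<Rightarrow> real mat" where
  "descending_eigenvalue_matrix A =
     mat_diag (dim_row A) (\<lambda>i. rev (sorted_list_of_set (spectrum A)) ! i)"

text \<open>The power \<open>V\<^sup>-\<^sup>1\<^sup>/\<^sup>2\<close> of a diagonal matrix with positive diagonal entries.\<close>

definition diag_inv_sqrt :: "real mat \<Rightarrow> real mat" where
  "diag_inv_sqrt V = mat_diag (dim_row V) (\<lambda>i. (V $$ (i, i)) powr (- 1 / 2))"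

text \<open>A predicate rather than a function: unit-norm eigenvectors are determined only up to sign.\<close>

definition is_rotation_matrix :: "real mat \<Rightarrow> real mat \<Rightarrow> real mat \<Rightarrow> bool" where
  "is_rotation_matrix F B H \<longleftrightarrow>
     (\<exists>\<Lambda> P V.
        \<Lambda> = descending_eigenvalue_matrix (eig_matrix F B) \<and>
        P \<in> carrier_mat (dim_col F) (dim_col F) \<and>
        (\<forall>i < dim_col F. eigenvector (eig_matrix F B) (col P i) (\<Lambda> $$ (i, i)) \<and>
                         sqrt (scalar_prod (col P i) (col P i)) = 1) \<and>
        V = transpose_mat P * second_moment F * P \<and>
        H = P * diag_inv_sqrt V)"

text \<open>The inverse of an invertible matrix; unspecified otherwise.\<close>

abbreviation inv_mat :: "real mat \<Rightarrow> real mat" where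
  "inv_mat A \<equiv> the (mat_inverse A)"

end

theory Submission
  imports Defs
begin

text \<open>Write \<open>M = T\<^sup>-\<^sup>1F'F\<close> for a pair \<open>(F, B)\<close>. Since \<open>P'M(B'B)MP = V\<Lambda>\<close> is symmetric and
  the entries of \<open>\<Lambda>\<close> are distinct, \<open>V\<close> is diagonal; hence \<open>H = PV\<^sup>-\<^sup>1\<^sup>/\<^sup>2\<close> satisfies \<open>H'MH = I\<close> and
  \<open>B'BMH = H\<Lambda>\<close>, so that \<open>(H')\<^sup>-\<^sup>1 = MH\<close>. By full column rank, \<open>F\<^sup>\<dagger>B\<^sup>\<dagger>' = F\<^sup>*B\<^sup>*'\<close> gives a matrix
  \<open>Q\<close> with \<open>F\<^sup>\<dagger> = F\<^sup>*Q\<close> and \<open>B\<^sup>* = B\<^sup>\<dagger>Q'\<close>. It intertwines the two eigenvalue problems, so they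
  share \<open>\<Lambda>\<close>, and both \<open>H\<close> and \<open>K = QH\<^sup>\<dagger>\<close> solve the same normalised problem. Then
  \<open>S = H\<^sup>-\<^sup>1K\<close> is orthogonal and commutes with \<open>\<Lambda>\<close>, so it is diagonal with entries \<open>\<plusminus>1\<close>.\<close>

lemma inv_mat_eqI:
  assumes A: "A \<in> carrier_mat n n" and B: "B \<in> carrier_mat n n" and AB: "A * B = 1\<^sub>m n"
  shows "inv_mat A = B"
proof -
  have BA: "B * A = 1\<^sub>m n" by (rule mat_mult_left_right_inverse[OF A B AB])
  have "A \<in> Units (ring_mat TYPE(real) n ())"
    using A B AB BA unfolding Units_def by (auto simp: ring_mat_simps)
  then obtain C where C: "mat_inverse A = Some C"
    using mat_inverse(1)[OF A, of "()"] by (cases "mat_inverse A") auto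
  have CA: "C * A = 1\<^sub>m n" and Cc: "C \<in> carrier_mat n n"
    using mat_inverse(2)[OF A C] by auto
  have "C = C * (A * B)" using AB Cc by simp
  also have "\<dots> = (C * A) * B" by (rule assoc_mult_mat[OF Cc A B, symmetric])
  also have "\<dots> = B" using CA B by simp
  finally show ?thesis using C by simp
qed

lemma left_inverse_if_smallest_eigenvalue_pos:
  assumes Y: "Y \<in> carrier_mat n m" and A: "A \<in> carrier_mat m n"
    and pos: "0 < smallest_eigenvalue (Y * A)"
  shows "\<exists>L \<in> carrier_mat n m. L * A = 1\<^sub>m n"
proof -
  have YA: "Y * A \<in> carrier_mat n n" using Y A by simp
  have "det (Y * A) \<noteq> 0"
  proof
    assume "det (Y * A) = 0"
    then obtain v where v: "v \<in> carrier_vec n" "v \<noteq> 0\<^sub>v n" "(Y * A) *\<^sub>v v = 0\<^sub>v n"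
      using det_0_iff_vec_prod_zero_field[OF YA] by blast
    moreover have "0 \<cdot>\<^sub>v v = 0\<^sub>v n" using v(1) by auto
    ultimately have "eigenvector (Y * A) v 0"
      using Y unfolding eigenvector_def by simp
    then have "0 \<in> spectrum (Y * A)" unfolding spectrum_def eigenvalue_def by auto
    then have "smallest_eigenvalue (Y * A) \<le> 0"
      unfolding smallest_eigenvalue_def using card_finite_spectrum(1)[OF YA] by simp
    then show False using pos by simp
  qed
  then have "Y * A \<in> Units (ring_mat TYPE(real) n ())"
    by (rule det_non_zero_imp_unit[OF YA])
  then obtain G where G: "G \<in> carrier_mat n n" "G * (Y * A) = 1\<^sub>m n"
    unfolding Units_def by (auto simp: ring_mat_simps)
  have "(G * Y) * A = 1\<^sub>m n" using G Y A by simp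
  then show ?thesis using G Y by (intro bexI[of _ "G * Y"]) auto
qed

lemma second_moment_carrier [simp]:
  assumes "F \<in> carrier_mat T r"
  shows "second_moment F \<in> carrier_mat r r"
  using assms unfolding second_moment_def by auto

lemma eig_matrix_carrier [simp]:
  assumes "F \<in> carrier_mat T r" "B \<in> carrier_mat N r"
  shows "eig_matrix F B \<in> carrier_mat r r"
  using assms unfolding eig_matrix_def
  by (meson mult_carrier_mat second_moment_carrier transpose_carrier_mat)

lemma transpose_second_moment:
  assumes "F \<in> carrier_mat T r"
  shows "transpose_mat (second_moment F) = second_moment F"
proof -
  have "transpose_mat (transpose_mat F * F) = transpose_mat F * F"
    using assms by (subst transpose_mult[of _ r T _ r]) auto
  then show ?thesis
    using assms unfolding second_moment_def
    by (metis map_mat_transpose smult_mat_def)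
qed

lemma factor_left_inverses:
  assumes F: "F \<in> carrier_mat T r" and B: "B \<in> carrier_mat N r"
    and fc: "factor_condition c F B"
  obtains L K where "L \<in> carrier_mat r T" "L * F = 1\<^sub>m r"
    and "K \<in> carrier_mat r N" "K * B = 1\<^sub>m r"
proof -
  have "second_moment F = ((1 / real (dim_row F)) \<cdot>\<^sub>m transpose_mat F) * F"
    using F unfolding second_moment_def by (subst mult_smult_assoc_mat[of _ r T _ r]) auto
  then have 1: "0 < smallest_eigenvalue (((1 / real (dim_row F)) \<cdot>\<^sub>m transpose_mat F) * F)"
    using fc unfolding factor_condition_def by simp
  have 2: "0 < smallest_eigenvalue (transpose_mat B * B)"
    using fc unfolding factor_condition_def by simp
  show ?thesis
    using left_inverse_if_smallest_eigenvalue_pos[OF _ F 1]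
      left_inverse_if_smallest_eigenvalue_pos[OF _ B 2] F B that by auto
qed

lemma scalar_prod_self_pos:
  fixes v :: "real vec"
  assumes v: "v \<in> carrier_vec n" and nz: "v \<noteq> 0\<^sub>v n"
  shows "0 < v \<bullet> v"
proof -
  obtain i where i: "i < n" "v $ i \<noteq> 0" using assms by (metis carrier_vecD eq_vecI index_zero_vec)
  have "0 < (\<Sum>j\<in>{0..<n}. v $ j * v $ j)"
    by (rule sum_pos2[of _ i]) (use i in \<open>auto simp: zero_less_mult_iff\<close>)
  then show ?thesis using v unfolding scalar_prod_def by simp
qed

lemma second_moment_pos:
  assumes F: "F \<in> carrier_mat T r" and T: "0 < T"
    and L: "L \<in> carrier_mat r T" "L * F = 1\<^sub>m r"
    and p: "p \<in> carrier_vec r" "p \<noteq> 0\<^sub>v r"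
  shows "0 < p \<bullet> (second_moment F *\<^sub>v p)"
proof -
  have Fp: "F *\<^sub>v p \<in> carrier_vec T" using F p by simp
  have "F *\<^sub>v p \<noteq> 0\<^sub>v T"
  proof
    assume "F *\<^sub>v p = 0\<^sub>v T"
    then have "L *\<^sub>v (F *\<^sub>v p) = 0\<^sub>v r" using L(1) by auto
    moreover have "L *\<^sub>v (F *\<^sub>v p) = p" using L F p by (metis assoc_mult_mat_vec one_mult_mat_vec)
    ultimately show False using p by simp
  qed
  then have pos: "0 < (F *\<^sub>v p) \<bullet> (F *\<^sub>v p)" by (rule scalar_prod_self_pos[OF Fp])
  have "second_moment F *\<^sub>v p = (1 / real T) \<cdot>\<^sub>v (transpose_mat F *\<^sub>v (F *\<^sub>v p))"
  proof -
    have "(a \<cdot>\<^sub>m X) *\<^sub>v p = a \<cdot>\<^sub>v (X *\<^sub>v p)" if "X \<in> carrier_mat r r" for a X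
      using that p by (intro eq_vecI) auto
    then have "second_moment F *\<^sub>v p = (1 / real T) \<cdot>\<^sub>v ((transpose_mat F * F) *\<^sub>v p)"
      using F unfolding second_moment_def
      by (metis carrier_matD(1) mult_carrier_mat transpose_carrier_mat)
    also have "(transpose_mat F * F) *\<^sub>v p = transpose_mat F *\<^sub>v (F *\<^sub>v p)"
      using F p by (intro assoc_mult_mat_vec[of _ r T]) auto
    finally show ?thesis .
  qed
  then have "p \<bullet> (second_moment F *\<^sub>v p) = (1 / real T) * (p \<bullet> (transpose_mat F *\<^sub>v (F *\<^sub>v p)))"
    using F p by simp
  also have "p \<bullet> (transpose_mat F *\<^sub>v (F *\<^sub>v p)) = (transpose_mat F *\<^sub>v (F *\<^sub>v p)) \<bullet> p"
    using F p by (intro comm_scalar_prod[of _ r]) auto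
  also have "\<dots> = (F *\<^sub>v p) \<bullet> (F *\<^sub>v p)" by (rule transpose_vec_mult_scalar[OF F p(1) Fp])
  finally show ?thesis using pos T by simp
qed

lemma diagonal_mat_if_commutes_mat_diag:
  fixes X :: "'a :: idom mat"
  assumes X: "X \<in> carrier_mat n n" and inj: "inj_on d {..<n}"
    and comm: "X * mat_diag n d = mat_diag n d * X"
  shows "diagonal_mat X"
  unfolding diagonal_mat_def
proof (intro allI impI)
  fix i j assume "i < dim_row X" "j < dim_col X" and ij: "i \<noteq> j"
  then have i: "i < n" and j: "j < n" using X by auto
  have "(X * mat_diag n d) $$ (i, j) = (mat_diag n d * X) $$ (i, j)" using comm by simp
  then have "X $$ (i, j) * d j = d i * X $$ (i, j)"
    using i j mat_diag_mult_left[OF X] mat_diag_mult_right[OF X] by simp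
  then have "X $$ (i, j) * (d j - d i) = 0" by (simp add: algebra_simps)
  moreover have "d j \<noteq> d i" using inj i j ij by (auto simp: inj_on_def)
  ultimately show "X $$ (i, j) = 0" by simp
qed

lemma diag_inv_sqrt_normalises:
  fixes V :: "real mat"
  assumes V: "V \<in> carrier_mat n n" and diag: "diagonal_mat V"
    and pos: "\<And>i. i < n \<Longrightarrow> 0 < V $$ (i, i)"
  shows "diag_inv_sqrt V * V * diag_inv_sqrt V = 1\<^sub>m n"
proof -
  let ?f = "\<lambda>i. (V $$ (i, i)) powr (- 1 / 2)"
  have D: "diag_inv_sqrt V = mat_diag n ?f" using V unfolding diag_inv_sqrt_def by simp
  have sq: "x powr (- 1 / 2) * x * x powr (- 1 / 2) = 1" if "0 < x" for x :: real
  proof -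
    have "x powr (- 1 / 2) * x * x powr (- 1 / 2) = x powr (- 1 / 2 + 1 + - 1 / 2)"
      using that by (simp only: powr_add powr_one less_imp_le)
    then show ?thesis using that by simp
  qed
  have DV: "mat_diag n ?f * V \<in> carrier_mat n n" using V by (meson mat_diag_dim mult_carrier_mat)
  have "mat_diag n ?f * V * mat_diag n ?f = 1\<^sub>m n"
  proof (rule eq_matI)
    fix i j assume "i < dim_row (1\<^sub>m n :: real mat)" "j < dim_col (1\<^sub>m n :: real mat)"
    then have ij: "i < n" "j < n" by auto
    then have "(mat_diag n ?f * V * mat_diag n ?f) $$ (i, j) = ?f i * V $$ (i, j) * ?f j"
      unfolding mat_diag_mult_right[OF DV] by (simp add: mat_diag_mult_left[OF V])
    then show "(mat_diag n ?f * V * mat_diag n ?f) $$ (i, j) = 1\<^sub>m n $$ (i, j)"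
      using ij sq[OF pos[OF ij(1)]] diag V unfolding diagonal_mat_def by (cases "i = j") auto
  qed (auto simp: mat_diag_def)
  then show ?thesis unfolding D .
qed

definition descending_eigenvalues :: "real mat \<Rightarrow> nat \<Rightarrow> real" where
  "descending_eigenvalues A i = rev (sorted_list_of_set (spectrum A)) ! i"

lemma inj_on_descending_eigenvalues:
  assumes "card (spectrum A) = n"
  shows "inj_on (descending_eigenvalues A) {..<n}"
  unfolding inj_on_def descending_eigenvalues_def
  using assms by (auto simp: nth_eq_iff_index_eq)

lemma rotation_matrix_properties:
  assumes F: "F \<in> carrier_mat T r" and B: "B \<in> carrier_mat N r" and T: "0 < T"
    and fc: "factor_condition c F B" and rot: "is_rotation_matrix F B H"
  defines "D \<equiv> mat_diag r (descending_eigenvalues (eig_matrix F B))"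
  shows rotation_matrix_carrier: "H \<in> carrier_mat r r"
    and rotation_matrix_orthonormal: "transpose_mat H * (second_moment F * H) = 1\<^sub>m r"
    and rotation_matrix_diagonalises: "eig_matrix F B * H = H * D"
proof -
  let ?M = "second_moment F" and ?E = "eig_matrix F B" and ?A = "transpose_mat B * B"
  let ?d = "descending_eigenvalues ?E"
  have M: "?M \<in> carrier_mat r r" and E: "?E \<in> carrier_mat r r" and A: "?A \<in> carrier_mat r r"
    and Dc: "D \<in> carrier_mat r r"
    using F B by (auto simp: D_def)
  have \<Lambda>: "descending_eigenvalue_matrix ?E = D"
    unfolding descending_eigenvalue_matrix_def descending_eigenvalues_def D_def using E by simp
  from rot F obtain P where P: "P \<in> carrier_mat r r"
    and ev: "\<And>i. i < r \<Longrightarrow> eigenvector ?E (col P i) (D $$ (i, i))"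
    and H: "H = P * diag_inv_sqrt (transpose_mat P * ?M * P)"
    unfolding is_rotation_matrix_def \<Lambda> by auto
  define V where "V = transpose_mat P * ?M * P"
  define W where "W = diag_inv_sqrt V"
  note assoc = assoc_mult_mat[of _ r r _ r _ r]
  have Pt: "transpose_mat P \<in> carrier_mat r r" using P by simp
  have V: "V \<in> carrier_mat r r" using P M unfolding V_def by auto
  have W: "W \<in> carrier_mat r r" using V unfolding W_def diag_inv_sqrt_def by auto
  show Hc: "H \<in> carrier_mat r r" using P W H unfolding V_def W_def by auto
  have EP: "?E * P = P * D"
  proof (rule eq_matI)
    fix i j assume "i < dim_row (P * D)" "j < dim_col (P * D)"
    then have ij: "i < r" "j < r" using P Dc by auto
    have "(?E * P) $$ (i, j) = (?E *\<^sub>v col P j) $ i" using ij E P by simp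
    also have "\<dots> = ((D $$ (j, j)) \<cdot>\<^sub>v col P j) $ i"
      using ev[OF ij(2)] unfolding eigenvector_def by simp
    also have "\<dots> = P $$ (i, j) * ?d j" using ij P unfolding D_def mat_diag_def by simp
    also have "\<dots> = (P * D) $$ (i, j)" using ij mat_diag_mult_right[OF P] unfolding D_def by simp
    finally show "(?E * P) $$ (i, j) = (P * D) $$ (i, j)" .
  qed (use E P Dc in auto)
  have Mt: "transpose_mat ?M = ?M" by (rule transpose_second_moment[OF F])
  have At: "transpose_mat ?A = ?A" using B by (subst transpose_mult[of _ r N _ r]) auto
  have Dt: "transpose_mat D = D" unfolding D_def mat_diag_def by (rule eq_matI) auto
  have tm: "transpose_mat (X * Y) = transpose_mat Y * transpose_mat X"
    if "X \<in> carrier_mat r r" "Y \<in> carrier_mat r r" for X Y :: "real mat"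
    using that by (rule transpose_mult)
  have Vt: "transpose_mat V = V" unfolding V_def using P M Mt by (simp add: tm assoc)
  have VD: "V * D = transpose_mat P * (?M * (?A * (?M * P)))"
  proof -
    have "V * D = transpose_mat P * (?M * (P * D))" unfolding V_def using P M Dc by (simp add: assoc)
    also have "P * D = ?A * (?M * P)" using EP P M A unfolding eig_matrix_def by (metis assoc)
    finally show ?thesis .
  qed
  have X: "?M * P \<in> carrier_mat r r" "?A * (?M * P) \<in> carrier_mat r r"
    "?M * (?A * (?M * P)) \<in> carrier_mat r r"
    using P M A by (meson mult_carrier_mat)+
  have "D * V = transpose_mat (V * D)" using V Dc Vt Dt by (simp add: tm)
  also have "\<dots> = transpose_mat (transpose_mat P * (?M * (?A * (?M * P))))" unfolding VD ..
  also have "\<dots> = ((transpose_mat P * ?M) * ?A * ?M) * P"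
    unfolding tm[OF Pt X(3)] tm[OF M X(2)] tm[OF A X(1)] tm[OF M P] Mt At by simp
  also have "\<dots> = transpose_mat P * (?M * (?A * (?M * P)))"
  proof -
    have Y: "transpose_mat P * ?M \<in> carrier_mat r r" using Pt M by simp
    have Z: "transpose_mat P * ?M * ?A \<in> carrier_mat r r" using Y A by (meson mult_carrier_mat)
    show ?thesis
      unfolding assoc[OF Z M P] assoc[OF Y A X(1)] assoc[OF Pt M X(2)] ..
  qed
  finally have comm: "V * D = D * V" using VD by simp
  have inj: "inj_on ?d {..<r}"
    using fc F by (intro inj_on_descending_eigenvalues) (auto simp: factor_condition_def)
  have diagV: "diagonal_mat V"
    using diagonal_mat_if_commutes_mat_diag[OF V inj] comm unfolding D_def by simp
  obtain L where L: "L \<in> carrier_mat r T" "L * F = 1\<^sub>m r"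
    using factor_left_inverses[OF F B fc] by blast
  have "0 < V $$ (i, i)" if i: "i < r" for i
  proof -
    have "V = transpose_mat P * (?M * P)" unfolding V_def using P M by (simp add: assoc)
    then have "V $$ (i, i) = col P i \<bullet> (?M *\<^sub>v col P i)"
      using i P M by (simp add: mult_mat_vec_def)
    moreover have "col P i \<noteq> 0\<^sub>v r" "col P i \<in> carrier_vec r"
      using ev[OF i] E unfolding eigenvector_def by auto
    ultimately show ?thesis using second_moment_pos[OF F T L] by simp
  qed
  then have "W * V * W = 1\<^sub>m r"
    unfolding W_def using diag_inv_sqrt_normalises[OF V diagV] by simp
  moreover have HW: "H = P * W" unfolding H W_def V_def ..
  moreover have Wt: "transpose_mat W = W"
    unfolding W_def diag_inv_sqrt_def mat_diag_def by (rule eq_matI) auto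
  ultimately show "transpose_mat H * (?M * H) = 1\<^sub>m r"
    using P M W Pt by (simp add: V_def tm assoc)
  have WD: "W * D = D * W"
    using V unfolding W_def D_def diag_inv_sqrt_def by (simp add: mult.commute)
  have "?E * H = (?E * P) * W" unfolding HW using E P W by (simp add: assoc)
  also have "\<dots> = P * (D * W)" unfolding EP using P Dc W by (simp add: assoc)
  also have "\<dots> = H * D" unfolding WD[symmetric] HW using P Dc W by (simp add: assoc)
  finally show "?E * H = H * D" .
qed

lemma factor_pairs_transition:
  assumes Fs: "Fs \<in> carrier_mat T r" and Bs: "Bs \<in> carrier_mat N r"
    and Fd: "Fd \<in> carrier_mat T r" and Bd: "Bd \<in> carrier_mat N r"
    and fcs: "factor_condition c Fs Bs" and fcd: "factor_condition c' Fd Bd"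
    and eq: "Fd * transpose_mat Bd = Fs * transpose_mat Bs"
  obtains Q where "Q \<in> carrier_mat r r" "Fd = Fs * Q" "Bs = Bd * transpose_mat Q"
proof -
  obtain L where L: "L \<in> carrier_mat r T" "L * Fs = 1\<^sub>m r"
    using factor_left_inverses[OF Fs Bs fcs] by blast
  obtain K where K: "K \<in> carrier_mat r N" "K * Bd = 1\<^sub>m r"
    using factor_left_inverses[OF Fd Bd fcd] by blast
  have Kt: "transpose_mat K \<in> carrier_mat N r" and Bdt: "transpose_mat Bd \<in> carrier_mat r N"
    and Bst: "transpose_mat Bs \<in> carrier_mat r N"
    using K Bd Bs by auto
  have BK: "transpose_mat Bd * transpose_mat K = 1\<^sub>m r"
    using transpose_mult[OF K(1) Bd] K(2) by simp
  define Q where "Q = L * Fd"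
  have Q: "Q \<in> carrier_mat r r" using L Fd unfolding Q_def by simp
  have "Q * transpose_mat Bd = L * (Fs * transpose_mat Bs)"
    unfolding Q_def eq[symmetric] by (rule assoc_mult_mat[OF L(1) Fd Bdt])
  also have "\<dots> = (L * Fs) * transpose_mat Bs" by (rule assoc_mult_mat[OF L(1) Fs Bst, symmetric])
  also have "\<dots> = transpose_mat Bs" unfolding L(2) using Bst by simp
  finally have QB: "Q * transpose_mat Bd = transpose_mat Bs" .
  have "Fd = Fd * (transpose_mat Bd * transpose_mat K)" using BK Fd by simp
  also have "\<dots> = (Fs * (Q * transpose_mat Bd)) * transpose_mat K"
    unfolding QB eq[symmetric] by (rule assoc_mult_mat[OF Fd Bdt Kt, symmetric])
  also have "\<dots> = ((Fs * Q) * transpose_mat Bd) * transpose_mat K"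
    by (simp only: assoc_mult_mat[OF Fs Q Bdt])
  also have "\<dots> = (Fs * Q) * (transpose_mat Bd * transpose_mat K)"
    using Fs Q Bdt Kt by (intro assoc_mult_mat[of _ T r _ N _ r]) auto
  also have "\<dots> = Fs * Q" using BK Fs Q by simp
  finally have "Fd = Fs * Q" .
  moreover have "Bs = Bd * transpose_mat Q"
    using transpose_mult[OF Q Bdt] QB by (metis transpose_transpose)
  ultimately show ?thesis using Q that by blast
qed

lemma second_moment_mult:
  assumes F: "F \<in> carrier_mat T r" and Q: "Q \<in> carrier_mat r r"
  shows "second_moment (F * Q) = transpose_mat Q * (second_moment F * Q)"
proof -
  have Ft: "transpose_mat F \<in> carrier_mat r T" and Qt: "transpose_mat Q \<in> carrier_mat r r"
    and FF: "transpose_mat F * F \<in> carrier_mat r r" and FQ: "F * Q \<in> carrier_mat T r"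
    using F Q by auto
  have "transpose_mat (F * Q) * (F * Q) = transpose_mat Q * (transpose_mat F * (F * Q))"
    unfolding transpose_mult[OF F Q] by (rule assoc_mult_mat[OF Qt Ft FQ])
  also have "\<dots> = transpose_mat Q * ((transpose_mat F * F) * Q)"
    unfolding assoc_mult_mat[OF Ft F Q] ..
  finally have gram: "transpose_mat (F * Q) * (F * Q) = transpose_mat Q * ((transpose_mat F * F) * Q)" .
  have FFQ: "transpose_mat F * F * Q \<in> carrier_mat r r" using FF Q by (meson mult_carrier_mat)
  show ?thesis
    unfolding second_moment_def gram mult_smult_assoc_mat[OF FF Q] mult_smult_distrib[OF Qt FFQ]
    by simp
qed

theorem theorem2:
  fixes N T r :: nat and c c' :: real
    and Fs Fd Bs Bd H Hd F0 B0 :: "real mat"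
  assumes "0 < N" "0 < T" "0 < r"
    and "Fs \<in> carrier_mat T r" "Bs \<in> carrier_mat N r"
    and "Fd \<in> carrier_mat T r" "Bd \<in> carrier_mat N r"
    and "factor_condition c Fs Bs"
    and "factor_condition c' Fd Bd"
    and "Fd * transpose_mat Bd = Fs * transpose_mat Bs"
    and "is_rotation_matrix Fs Bs H"
    and "is_rotation_matrix Fd Bd Hd"
    and "F0 = Fs * H"
    and "B0 = Bs * inv_mat (transpose_mat H)"
  shows "\<exists>S \<in> carrier_mat r r. diagonal_mat S \<and>
           (\<forall>i < r. S $$ (i, i) = 1 \<or> S $$ (i, i) = -1) \<and>
           Fd * Hd = F0 * S \<and>
           Bd * inv_mat (transpose_mat Hd) = B0 * S"
proof -
  note T = assms(2) and Fs = assms(4) and Bs = assms(5) and Fd = assms(6) and Bd = assms(7)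
    and fcs = assms(8) and fcd = assms(9) and rots = assms(11) and rotd = assms(12)
    and F0 = assms(13) and B0 = assms(14)
  let ?Ms = "second_moment Fs" and ?Md = "second_moment Fd"
  let ?Es = "eig_matrix Fs Bs" and ?Ed = "eig_matrix Fd Bd"
  let ?Ad = "transpose_mat Bd * Bd"
  obtain Q where Q: "Q \<in> carrier_mat r r" and FQ: "Fd = Fs * Q" and BQ: "Bs = Bd * transpose_mat Q"
    using factor_pairs_transition[OF Fs Bs Fd Bd fcs fcd assms(10)] .
  note assoc = assoc_mult_mat[of _ r r _ r _ r]
  have tm: "transpose_mat (X * Y) = transpose_mat Y * transpose_mat X"
    if "X \<in> carrier_mat r r" "Y \<in> carrier_mat r r" for X Y :: "real mat"
    using that by (rule transpose_mult)
  have Qt: "transpose_mat Q \<in> carrier_mat r r" and Ms: "?Ms \<in> carrier_mat r r"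
    and Md: "?Md \<in> carrier_mat r r" and Es: "?Es \<in> carrier_mat r r"
    and Ed: "?Ed \<in> carrier_mat r r" and Ad: "?Ad \<in> carrier_mat r r"
    and Bdt: "transpose_mat Bd \<in> carrier_mat r N"
    using Q Fs Fd Bs Bd by auto
  have MQ: "?Md = transpose_mat Q * (?Ms * Q)"
    unfolding FQ by (rule second_moment_mult[OF Fs Q])
  have AQ: "transpose_mat Bs * Bs = Q * (?Ad * transpose_mat Q)"
  proof -
    have "transpose_mat Bs = Q * transpose_mat Bd" unfolding BQ using transpose_mult[OF Bd Qt] by simp
    then have "transpose_mat Bs * Bs = Q * (transpose_mat Bd * Bs)"
      using assoc_mult_mat[OF Q Bdt Bs] by simp
    also have "transpose_mat Bd * Bs = ?Ad * transpose_mat Q"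
      unfolding BQ by (rule assoc_mult_mat[OF Bdt Bd Qt, symmetric])
    finally show ?thesis .
  qed
  have QE: "Q * ?Ed = ?Es * Q"
  proof -
    have MsQ: "?Ms * Q \<in> carrier_mat r r" and AdQ: "?Ad * transpose_mat Q \<in> carrier_mat r r"
      using Ms Q Ad Qt by (meson mult_carrier_mat)+
    have QAQ: "Q * (?Ad * transpose_mat Q) \<in> carrier_mat r r" using Q AdQ by (meson mult_carrier_mat)
    have "?Es * Q = Q * (?Ad * transpose_mat Q) * (?Ms * Q)"
      unfolding eig_matrix_def AQ by (rule assoc[OF QAQ Ms Q])
    also have "\<dots> = Q * (?Ad * (transpose_mat Q * (?Ms * Q)))"
      unfolding assoc[OF Q AdQ MsQ] assoc[OF Ad Qt MsQ] ..
    finally show ?thesis unfolding eig_matrix_def MQ ..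
  qed
  have "spectrum ?Ed \<subseteq> spectrum ?Es"
  proof
    fix k assume "k \<in> spectrum ?Ed"
    then obtain v where v: "v \<in> carrier_vec r" "v \<noteq> 0\<^sub>v r" "?Ed *\<^sub>v v = k \<cdot>\<^sub>v v"
      using Ed unfolding spectrum_def eigenvalue_def eigenvector_def by auto
    obtain L where L: "L \<in> carrier_mat r T" "L * Fd = 1\<^sub>m r"
      using factor_left_inverses[OF Fd Bd fcd] by blast
    have "(L * Fs) * Q = 1\<^sub>m r" using L FQ assoc_mult_mat[OF L(1) Fs Q] by simp
    then have "(L * Fs) *\<^sub>v (Q *\<^sub>v v) = v"
      using assoc_mult_mat_vec[of "L * Fs" r r Q r v] L Fs Q v by simp
    moreover have "X *\<^sub>v 0\<^sub>v r = 0\<^sub>v r" if "X \<in> carrier_mat r r" for X :: "real mat"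
      using that by (intro eq_vecI) auto
    then have "(L * Fs) *\<^sub>v 0\<^sub>v r = 0\<^sub>v r" using L(1) Fs by (meson mult_carrier_mat)
    ultimately have nz: "Q *\<^sub>v v \<noteq> 0\<^sub>v r" using v(2) by auto
    have "?Es *\<^sub>v (Q *\<^sub>v v) = (Q * ?Ed) *\<^sub>v v"
      unfolding QE by (rule assoc_mult_mat_vec[OF Es Q v(1), symmetric])
    also have "\<dots> = Q *\<^sub>v (k \<cdot>\<^sub>v v)" using assoc_mult_mat_vec[OF Q Ed v(1)] v(3) by simp
    also have "\<dots> = k \<cdot>\<^sub>v (Q *\<^sub>v v)" by (rule mult_mat_vec[OF Q v(1)])
    finally have "eigenvector ?Es (Q *\<^sub>v v) k" using nz Q v(1) Es unfolding eigenvector_def by auto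
    then show "k \<in> spectrum ?Es" unfolding spectrum_def eigenvalue_def by auto
  qed
  moreover have "card (spectrum ?Es) = r" "card (spectrum ?Ed) = r"
    using fcs fcd Fs Fd unfolding factor_condition_def by auto
  ultimately have spec: "spectrum ?Ed = spectrum ?Es"
    using card_finite_spectrum(1)[OF Es] by (intro card_subset_eq) auto
  define d where "d = descending_eigenvalues ?Es"
  have dd: "descending_eigenvalues ?Ed = d"
    unfolding d_def descending_eigenvalues_def spec ..
  define D where "D = mat_diag r d"
  have D: "D \<in> carrier_mat r r" unfolding D_def by simp
  have inj: "inj_on d {..<r}"
    unfolding d_def by (rule inj_on_descending_eigenvalues) fact
  note H = rotation_matrix_carrier[OF Fs Bs T fcs rots]
    and HH = rotation_matrix_orthonormal[OF Fs Bs T fcs rots]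
    and HD = rotation_matrix_diagonalises[OF Fs Bs T fcs rots, folded d_def, folded D_def]
  note Hd = rotation_matrix_carrier[OF Fd Bd T fcd rotd]
    and HHd = rotation_matrix_orthonormal[OF Fd Bd T fcd rotd]
    and HDd = rotation_matrix_diagonalises[OF Fd Bd T fcd rotd, unfolded dd, folded D_def]
  have Ht: "transpose_mat H \<in> carrier_mat r r" and Hdt: "transpose_mat Hd \<in> carrier_mat r r"
    and MH: "?Ms * H \<in> carrier_mat r r" and MHd: "?Md * Hd \<in> carrier_mat r r"
    using H Hd Ms Md by auto
  define K where "K = Q * Hd"
  define S where "S = transpose_mat H * (?Ms * K)"
  have K: "K \<in> carrier_mat r r" using Q Hd unfolding K_def by simp
  have MK: "?Ms * K \<in> carrier_mat r r" using Ms K by simp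
  have S: "S \<in> carrier_mat r r" unfolding S_def using Ht MK by simp
  have HtM: "transpose_mat H * ?Ms \<in> carrier_mat r r" using Ht Ms by simp
  have inv1: "(transpose_mat H * ?Ms) * H = 1\<^sub>m r" using HH assoc[OF Ht Ms H] by simp
  then have inv2: "H * (transpose_mat H * ?Ms) = 1\<^sub>m r"
    by (rule mat_mult_left_right_inverse[OF HtM H])
  have S': "S = (transpose_mat H * ?Ms) * K" unfolding S_def by (rule assoc[OF Ht Ms K, symmetric])
  have HS: "H * S = K" unfolding S' using assoc[OF H HtM K] inv2 K by simp
  have MdHd: "?Md * Hd = transpose_mat Q * (?Ms * K)"
  proof -
    have MsQ: "?Ms * Q \<in> carrier_mat r r" using Ms Q by simp
    show ?thesis
      unfolding MQ K_def assoc[OF Qt MsQ Hd] assoc[OF Ms Q Hd] ..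
  qed
  have KK: "transpose_mat K * (?Ms * K) = 1\<^sub>m r"
  proof -
    have "transpose_mat K * (?Ms * K) = transpose_mat Hd * (transpose_mat Q * (?Ms * K))"
      unfolding K_def tm[OF Q Hd] using Hdt Qt MK unfolding K_def by (intro assoc)
    then show ?thesis using HHd MdHd by simp
  qed
  have St: "transpose_mat S * S = 1\<^sub>m r"
  proof -
    have "transpose_mat K = transpose_mat S * transpose_mat H" using tm[OF H S] HS by simp
    then have "1\<^sub>m r = (transpose_mat S * transpose_mat H) * (?Ms * K)" using KK by simp
    also have "\<dots> = transpose_mat S * S"
      using assoc[of "transpose_mat S", OF _ Ht MK] S unfolding S_def by simp
    finally show ?thesis by simp
  qed
  have EK: "?Es * K = K * D"
  proof -
    have "?Es * K = (Q * ?Ed) * Hd" unfolding K_def QE by (rule assoc[OF Es Q Hd, symmetric])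
    also have "\<dots> = Q * (Hd * D)" using assoc[OF Q Ed Hd] HDd by simp
    also have "\<dots> = K * D" unfolding K_def by (rule assoc[OF Q Hd D, symmetric])
    finally show ?thesis .
  qed
  have "H * (S * D) = H * (D * S)"
  proof -
    have "H * (S * D) = K * D" using assoc[OF H S D] HS by simp
    also have "\<dots> = (?Es * H) * S" using EK HS assoc[OF Es H S] by simp
    also have "\<dots> = H * (D * S)" unfolding HD by (rule assoc[OF H D S])
    finally show ?thesis .
  qed
  then have "(transpose_mat H * ?Ms) * (H * (S * D)) = (transpose_mat H * ?Ms) * (H * (D * S))"
    by simp
  moreover have "(transpose_mat H * ?Ms) * (H * X) = X" if X: "X \<in> carrier_mat r r" for X
    using assoc[OF HtM H X] inv1 X by simp
  ultimately have "S * D = D * S" using S D by simp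
  then have diag: "diagonal_mat S"
    unfolding D_def by (rule diagonal_mat_if_commutes_mat_diag[OF S inj])
  have sign: "S $$ (i, i) = 1 \<or> S $$ (i, i) = -1" if i: "i < r" for i
  proof -
    have "1 = (transpose_mat S * S) $$ (i, i)" using St i by simp
    also have "\<dots> = (\<Sum>j\<in>{0..<r}. S $$ (j, i) * S $$ (j, i))"
      using i S by (simp add: scalar_prod_def)
    also have "\<dots> = (\<Sum>j\<in>{i}. S $$ (j, i) * S $$ (j, i))"
      using i S diag unfolding diagonal_mat_def by (intro sum.mono_neutral_right) auto
    finally have "(S $$ (i, i))\<^sup>2 = 1" by (simp add: power2_eq_square)
    then show ?thesis by (simp add: power2_eq_1_iff)
  qed
  have "Fd * Hd = Fs * (H * S)"
    unfolding FQ HS K_def by (rule assoc_mult_mat[OF Fs Q Hd])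
  then have "Fd * Hd = F0 * S" unfolding F0 using assoc_mult_mat[OF Fs H S] by simp
  moreover have "Bd * inv_mat (transpose_mat Hd) = B0 * S"
  proof -
    have "inv_mat (transpose_mat Hd) = transpose_mat Q * (?Ms * K)"
      using inv_mat_eqI[OF Hdt MHd HHd] MdHd by simp
    then have "Bd * inv_mat (transpose_mat Hd) = Bs * (?Ms * (H * S))"
      unfolding BQ HS using assoc_mult_mat[OF Bd Qt MK] by simp
    also have "\<dots> = Bs * ((?Ms * H) * S)" unfolding assoc[OF Ms H S] ..
    also have "\<dots> = Bs * (?Ms * H) * S" by (rule assoc_mult_mat[OF Bs MH S, symmetric])
    also have "\<dots> = B0 * S" unfolding B0 inv_mat_eqI[OF Ht MH HH] ..
    finally show ?thesis .
  qed
  ultimately show ?thesis using S diag sign by blast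
qed

end
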